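(* Consider the polynomial decay change-point model. If the link function $\widetilde\Psi$ is continuous and $r>1$, then for any block $\Xi\in[K]^\ell$ and any $\epsilon>0$ there exists a positive integer $M(\Xi,\epsilon)$ such that for any $M\ge M(\Xi,\epsilon)$ $$\sup_{t\ge0,\,z\in[K]^t,\,j\in[\ell]}\Big|\frac1M\sum_{s=1}^M\omega\big(\pi_{t+s}(z,\Xi(j:s+j-1))\big)-d(\Xi)\Big|\le\epsilon,\qquad d(\Xi)=\frac1\ell\sum_{j=1}^\ell\omega\big(\widetilde\Psi(\chi_j)\big),$$ where $\omega(x)=|\log(1-x)|$ and $$\chi_j=\sum_{i=j-\ell+1}^jq_{\Xi(i)}\Big(\sum_{\iota=0}^\infty(j+1-i+\iota\ell)^{-r}\Big),\qquad1\le j\le\ell.$$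
   Context: Fix $K\ge2$, $[K]=\{1,\dots,K\}$. In the change-point model, $\pi_t(x_1,\dots,x_t)\in[0,1)$ is the conditional probability that the change occurs at time $t$, given that it has not occurred before and that treatments $x_1,\dots,x_t\in[K]$ have been assigned. Polynomial decay model: $\pi_t(x_1,\dots,x_t)=\widetilde\Psi\big(\sum_{s=1}^tq_{x_s}(t-s+1)^{-r}\big)$, $t\ge1$, where $\widetilde\Psi:[0,\infty]\to[0,1)$, $r>0$, $q_x\ge0$ for $x\in[K]$. A block $\Xi\in[K]^\ell$ is extended cyclically: $\Xi(m\ell+i)=\Xi(i)$ for every integer $m$, $1\le i\le\ell$; $\Xi(i:j)=(\Xi(i),\dots,\Xi(j))$. In $\pi_{t+s}(z,\Xi(j:s+j-1))$ the first $t$ treatments are $z$ and the next $s$ are $\Xi(j),\dots,\Xi(s+j-1)$. *)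

theory Defs
  imports Complex_Main "HOL-Library.Extended_Nonnegative_Real"
begin

text \<open>The set \<open>[K]\<^sup>t\<close>; a tuple \<open>(x\<^sub>1, \<dots>, x\<^sub>t)\<close> is a list, so that \<open>x\<^sub>s\<close> is \<open>x ! (s - 1)\<close>.\<close>

definition words :: "nat \<Rightarrow> nat \<Rightarrow> nat list set" where
  "words K t = {x. length x = t \<and> set x \<subseteq> {1..K}}"

definition cyc :: "nat list \<Rightarrow> int \<Rightarrow> nat" where
  "cyc \<Xi> i = \<Xi> ! nat ((i - 1) mod int (length \<Xi>))"

lemma cyc_shift:
  assumes "1 \<le> i" "i \<le> length \<Xi>"
  shows "cyc \<Xi> (m * int (length \<Xi>) + int i) = \<Xi> ! (i - 1)"
proof -
  have "(m * int (length \<Xi>) + int i - 1) mod int (length \<Xi>)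
      = ((int i - 1) + m * int (length \<Xi>)) mod int (length \<Xi>)"
    by (simp add: algebra_simps)
  also have "\<dots> = (int i - 1) mod int (length \<Xi>)"
    by (rule mod_mult_self1)
  also have "\<dots> = int (i - 1)"
    using assms by (simp add: of_nat_diff)
  finally show ?thesis
    by (simp add: cyc_def)
qed

definition seg :: "nat list \<Rightarrow> int \<Rightarrow> int \<Rightarrow> nat list" where
  "seg \<Xi> i j = map (cyc \<Xi>) [i..j]"

text \<open>The hazard \<open>\<pi>\<^sub>t(x\<^sub>1, \<dots>, x\<^sub>t)\<close> of the polynomial decay model, with \<open>t = length x\<close>. The
  domain \<open>[0, \<infinity>]\<close> of the link function is the type \<^typ>\<open>ennreal\<close>.\<close>

definition hazard :: "(ennreal \<Rightarrow> real) \<Rightarrow> (nat \<Rightarrow> real) \<Rightarrow> real \<Rightarrow> nat list \<Rightarrow> real" where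
  "hazard \<Psi> q r x =
     \<Psi> (ennreal (\<Sum>s=1..length x. q (x ! (s - 1)) * (real (length x) - real s + 1) powr (- r)))"

definition omega :: "real \<Rightarrow> real" where
  "omega x = \<bar>ln (1 - x)\<bar>"

definition chi :: "(nat \<Rightarrow> real) \<Rightarrow> real \<Rightarrow> nat list \<Rightarrow> int \<Rightarrow> ennreal" where
  "chi q r \<Xi> j =
     (\<Sum>i = j - int (length \<Xi>) + 1..j. ennreal (q (cyc \<Xi> i)) *
        (\<Sum>\<iota>. ennreal ((real_of_int (j + 1 - i) + real \<iota> * real (length \<Xi>)) powr (- r))))"

definition dlim :: "(ennreal \<Rightarrow> real) \<Rightarrow> (nat \<Rightarrow> real) \<Rightarrow> real \<Rightarrow> nat list \<Rightarrow> real" where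
  "dlim \<Psi> q r \<Xi> =
     1 / real (length \<Xi>) * (\<Sum>j = 1..int (length \<Xi>). omega (\<Psi> (chi q r \<Xi> j)))"

end

theory Submission
  imports Defs "HOL-Analysis.Analysis"
begin

text \<open>As \<open>r > 1\<close>, the weights \<open>k\<^sup>-\<^sup>r\<close> are summable, so after \<open>s\<close> steps of the cyclically
  repeated block the initial treatments \<open>z\<close> contribute at most a constant times
  \<open>\<Sum>k>s. k\<^sup>-\<^sup>r\<close>. Hence the argument of the link function is, uniformly in \<open>z\<close>, close to the effect
  of an infinite periodic past, which is periodic in \<open>s\<close> with values \<open>\<chi>\<^sub>1, \<dots>, \<chi>\<^sub>l\<close>. All arguments lie
  in a compact interval, on which \<open>\<omega> \<circ> \<Psi>\<close> is bounded and uniformly continuous, so the averages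
  differ from the mean over one period by at most \<open>\<epsilon> / 2\<close> plus \<open>O(1 / M)\<close>.\<close>

section \<open>Periodic sums and weighted series\<close>

lemma periodic_window_sum:
  fixes h :: "int \<Rightarrow> 'a::ab_group_add"
  assumes per: "\<And>p. h (p + int l) = h p"
  shows "(\<Sum>m<l. h (p + int m)) = (\<Sum>j=1..int l. h j)"
proof -
  define F where "F p = (\<Sum>m<l. h (p + int m))" for p
  have step: "F (p + 1) = F p" for p
  proof -
    \<comment> \<open>Splitting \<open>l + 1\<close> consecutive terms at either end shows that a
      shift of the window replaces \<open>h p\<close> by the equal value
      \<open>h (p + int l)\<close>.\<close>
    have "F p + h (p + int l) = (\<Sum>m<Suc l. h (p + int m))"
      by (simp add: F_def)
    also have "\<dots> = h p + F (p + 1)"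
      by (simp add: F_def sum.lessThan_Suc_shift algebra_simps del: sum.lessThan_Suc)
    finally show ?thesis
      by (simp add: per)
  qed
  have "F p = F 1"
  proof (induction p rule: int_induct[where k = 1])
    case (step2 i)
    then show ?case using step[of "i - 1"] by simp
  qed (simp_all add: step)
  also have "F 1 = (\<Sum>j=1..int l. h j)"
    unfolding F_def
    by (rule sum.reindex_bij_witness[of _ "\<lambda>j. nat (j - 1)" "\<lambda>m. 1 + int m"]) auto
  finally show ?thesis
    by (simp add: F_def)
qed

text \<open>Each full period contributes exactly \<open>l * D\<close>, so stripping off periods
  leaves fewer than \<open>l\<close> terms, and there both quantities lie between \<open>0\<close>
  and \<open>l * G\<close>. The error neither grows with \<open>M\<close> nor depends on
  \<open>p\<close>.\<close>

lemma periodic_partial_sum_bound: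
  fixes h :: "int \<Rightarrow> real"
  assumes per: "\<And>p. h (p + int l) = h p" and l: "l > 0"
    and bd: "\<And>p. 0 \<le> h p" "\<And>p. h p \<le> G"
    and D: "D = 1 / real l * (\<Sum>j=1..int l. h j)"
  shows "\<bar>(\<Sum>m<M. h (p + int m)) - real M * D\<bar> \<le> real l * G"
proof (induction M rule: less_induct)
  case (less M)
  show ?case
  proof (cases "M < l")
    case True
    have D0: "0 \<le> D"
      using bd by (simp add: D sum_nonneg)
    have "(\<Sum>j=1..int l. h j) \<le> real l * G"
      using sum_bounded_above[of "{1..int l}" h G] bd by simp
    then have DG: "D \<le> G"
      using l by (simp add: D field_simps)
    have "(\<Sum>m<M. h (p + int m)) \<le> real M * G"
      using sum_bounded_above[of "{..<M}" "\<lambda>m. h (p + int m)" G] bd by simp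
    moreover have "0 \<le> (\<Sum>m<M. h (p + int m))"
      using bd by (simp add: sum_nonneg)
    moreover have "real M * D \<le> real M * G" "0 \<le> real M * D" "real M * G \<le> real l * G"
      using D0 DG True by (auto intro!: mult_left_mono mult_right_mono)
    ultimately show ?thesis
      by linarith
  next
    case False
    then obtain N where N: "M = N + l"
      by (metis add.commute le_add_diff_inverse not_less)
    have "(\<Sum>m<M. h (p + int m)) =
        (\<Sum>m<N. h (p + int m)) + (\<Sum>m=N..<N + l. h (p + int m))"
      by (simp add: N lessThan_atLeast0 sum.atLeastLessThan_concat)
    also have "(\<Sum>m=N..<N + l. h (p + int m)) = (\<Sum>m<l. h ((p + int N) + int m))"
      by (rule sum.reindex_bij_witness[of _ "\<lambda>m. N + m" "\<lambda>m. m - N"]) (auto simp: algebra_simps)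
    also have "\<dots> = real l * D"
      using l periodic_window_sum[of h, OF per] by (simp add: D)
    finally show ?thesis
      using less[of N] l by (simp add: N algebra_simps)
  qed
qed

text \<open>After padding \<open>b\<close> with zeros from \<open>n\<close> on, the coefficients
  differ by at most \<open>Q\<close>, and not at all below \<open>s\<close>, so only the tail of
  \<open>a\<close> survives. This serves to compare a finite history \<open>b\<close> with an
  infinite periodic past \<open>c\<close>.\<close>

lemma weighted_sum_tail_bound:
  fixes a b c :: "nat \<Rightarrow> real"
  assumes a: "\<And>k. 0 \<le> a k" "summable a"
    and b: "\<And>k. k < n \<Longrightarrow> 0 \<le> b k \<and> b k \<le> Q"
    and c: "\<And>k. 0 \<le> c k \<and> c k \<le> Q"
    and eq: "\<And>k. k < s \<Longrightarrow> b k = c k" and "s \<le> n"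
  shows "\<bar>(\<Sum>k<n. b k * a k) - (\<Sum>k. c k * a k)\<bar> \<le> Q * (\<Sum>k. a (k + s))"
proof -
  define e where "e k = ((if k < n then b k else 0) - c k) * a k" for k
  have Q: "0 \<le> Q"
    using c[of 0] by linarith
  have e_bd: "\<bar>e k\<bar> \<le> Q * a k" for k
    using b[of k] c[of k] Q a(1)[of k] by (auto simp: e_def abs_mult intro!: mult_right_mono)
  have sQ: "summable (\<lambda>k. Q * a k)"
    using a(2) by (rule summable_mult)
  have se: "summable e"
    by (rule summable_comparison_test'[OF sQ]) (use e_bd in auto)
  have sc: "summable (\<lambda>k. c k * a k)"
    by (rule summable_comparison_test'[OF sQ])
      (use c a(1) in \<open>auto simp: abs_mult intro!: mult_right_mono\<close>)
  have "(\<lambda>k. if k \<in> {..<n} then b k * a k else 0) sums (\<Sum>k<n. b k * a k)"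
    by (rule sums_If_finite_set) simp
  from sums_diff[OF this summable_sums[OF sc]]
  have "e sums ((\<Sum>k<n. b k * a k) - (\<Sum>k. c k * a k))"
    by (rule sums_cong[THEN iffD1, rotated]) (auto simp: e_def algebra_simps)
  then have "(\<Sum>k<n. b k * a k) - (\<Sum>k. c k * a k) = suminf e"
    by (rule sums_unique)
  also have "\<dots> = (\<Sum>k. e (k + s)) + (\<Sum>k<s. e k)"
    by (rule suminf_split_initial_segment[OF se])
  also have "(\<Sum>k<s. e k) = 0"
    using eq \<open>s \<le> n\<close> by (intro sum.neutral) (auto simp: e_def)
  finally have "\<bar>(\<Sum>k<n. b k * a k) - (\<Sum>k. c k * a k)\<bar> = norm (\<Sum>k. e (k + s))"
    by simp
  also have "\<dots> \<le> (\<Sum>k. Q * a (k + s))"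
    by (rule norm_suminf_le)
      (use e_bd summable_ignore_initial_segment[OF sQ, of s] in auto)
  also have "\<dots> = Q * (\<Sum>k. a (k + s))"
    by (rule suminf_mult) (rule summable_ignore_initial_segment[OF a(2)])
  finally show ?thesis .
qed

section \<open>The cyclic block and its infinite past\<close>

lemma cyc_add_length: "cyc \<Xi> (i + int m * int (length \<Xi>)) = cyc \<Xi> i"
proof -
  have "(i + int m * int (length \<Xi>) - 1) mod int (length \<Xi>)
      = ((i - 1) + int m * int (length \<Xi>)) mod int (length \<Xi>)"
    by (simp add: algebra_simps)
  then show ?thesis
    by (simp add: cyc_def)
qed

lemma cyc_in_set:
  assumes "\<Xi> \<noteq> []"
  shows "cyc \<Xi> i \<in> set \<Xi>"
proof -
  have "nat ((i - 1) mod int (length \<Xi>)) < length \<Xi>"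
    using assms by (simp add: nat_less_iff)
  then show ?thesis
    by (simp add: cyc_def)
qed

text \<open>The index \<open>k\<close> is the lag: \<open>0\<close> stands for the current
  treatment, whose weight is 1.\<close>

definition decay :: "real \<Rightarrow> nat \<Rightarrow> real" where
  "decay r k = real (Suc k) powr (- r)"

lemma decay_nonneg: "0 \<le> decay r k"
  by (simp add: decay_def)

lemma summable_decay:
  assumes "r > 1"
  shows "summable (decay r)"
proof -
  have "summable (\<lambda>k. real k powr (- r))"
    using assms by (simp add: summable_real_powr_iff)
  then show ?thesis
    unfolding decay_def by (subst summable_Suc_iff)
qed

text \<open>The effect of an infinite past in which the block has been repeated forever, up to and
  including position \<open>p\<close>; the real-valued counterpart of \<^const>\<open>chi\<close>.\<close>

definition stationary_effect :: "(nat \<Rightarrow> real) \<Rightarrow> real \<Rightarrow> nat list \<Rightarrow> int \<Rightarrow> real" where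
  "stationary_effect q r \<Xi> p = (\<Sum>k. q (cyc \<Xi> (p - int k)) * decay r k)"

lemma stationary_effect_periodic:
  "stationary_effect q r \<Xi> (p + int (length \<Xi>)) = stationary_effect q r \<Xi> p"
proof -
  have "cyc \<Xi> (p + int (length \<Xi>) - int k) = cyc \<Xi> (p - int k)" for k
    using cyc_add_length[of \<Xi> "p - int k" 1] by (simp add: algebra_simps)
  then show ?thesis
    by (simp add: stationary_effect_def)
qed

lemma summable_stationary_effect:
  assumes "r > 1" "\<And>p. 0 \<le> q (cyc \<Xi> p)" "\<And>p. q (cyc \<Xi> p) \<le> Q"
  shows "summable (\<lambda>k. q (cyc \<Xi> (p - int k)) * decay r k)"
  by (rule summable_comparison_test'[OF summable_mult[OF summable_decay[OF assms(1)], of Q]])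
    (use assms(2,3) in \<open>auto simp: abs_mult decay_nonneg intro!: mult_right_mono\<close>)

text \<open>With l the block length, every lag is uniquely \<open>(j - i) + \<iota> * l\<close> for
  some \<open>i\<close> among the last l positions, so sorting the lags by residue modulo l produces
  the inner series of \<open>chi\<close>. In particular \<open>chi\<close> is finite.\<close>

lemma chi_eq_stationary_effect:
  assumes "r > 1" "\<Xi> \<noteq> []" "\<And>p. 0 \<le> q (cyc \<Xi> p)" "\<And>p. q (cyc \<Xi> p) \<le> Q"
  shows "chi q r \<Xi> j = ennreal (stationary_effect q r \<Xi> j)"
proof -
  let ?l = "length \<Xi>"
  define f where "f k = q (cyc \<Xi> (j - int k)) * decay r k" for k
  define w where "w i \<iota> = q (cyc \<Xi> i) * (real_of_int (j + 1 - i) + real \<iota> * real ?l) powr (- r)"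
    for i :: int and \<iota> :: nat
  have w0: "0 \<le> w i \<iota>" for i \<iota>
    using assms(3) by (simp add: w_def)
  have f0: "0 \<le> f k" for k
    using assms(3) by (simp add: f_def decay_nonneg)
  have f_sums: "f sums stationary_effect q r \<Xi> j"
    unfolding f_def stationary_effect_def
    by (rule summable_sums[OF summable_stationary_effect[of r q \<Xi> Q, OF assms(1,3,4)]])
  have "0 \<le> stationary_effect q r \<Xi> j"
    using sums_le[OF f0 sums_zero f_sums] .
  \<comment> \<open>Lags are grouped by block length; group \<iota> lies \<iota> periods before the
    last \<open>?l\<close> positions.\<close>
  moreover have "(\<lambda>\<iota>. sum f {\<iota> * ?l..<\<iota> * ?l + ?l}) sums stationary_effect q r \<Xi> j"
    using f_sums assms(2) by (intro sums_group) auto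
  ultimately have sums: "(\<lambda>\<iota>. ennreal (sum f {\<iota> * ?l..<\<iota> * ?l + ?l}))
      sums ennreal (stationary_effect q r \<Xi> j)"
    using f0 by (subst sums_ennreal) (auto intro!: sum_nonneg)
  have group: "(\<Sum>i = j - int ?l + 1..j. w i \<iota>) = sum f {\<iota> * ?l..<\<iota> * ?l + ?l}" for \<iota>
  proof (rule sum.reindex_bij_witness[of _ "\<lambda>k. j - int (k - \<iota> * ?l)" "\<lambda>i. nat (j - i) + \<iota> * ?l"])
    fix i assume i: "i \<in> {j - int ?l + 1..j}"
    have "cyc \<Xi> (j - int (nat (j - i) + \<iota> * ?l)) = cyc \<Xi> i"
      using cyc_add_length[of \<Xi> "i - int \<iota> * int ?l" \<iota>] i by simp
    moreover have "real (Suc (nat (j - i) + \<iota> * ?l)) = real_of_int (j + 1 - i) + real \<iota> * real ?l"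
      using i by simp
    ultimately show "f (nat (j - i) + \<iota> * ?l) = w i \<iota>"
      unfolding f_def w_def decay_def by (simp only:)
  qed (auto simp: nat_less_iff simp del: of_nat_diff of_nat_mult)
  have "chi q r \<Xi> j = (\<Sum>i = j - int ?l + 1..j. \<Sum>\<iota>. ennreal (w i \<iota>))"
    unfolding chi_def w_def using assms(3) by (simp add: ennreal_mult)
  \<comment> \<open>Every series converges in \<open>ennreal\<close>, so the interchange needs no
    further argument.\<close>
  also have "\<dots> = (\<Sum>\<iota>. \<Sum>i = j - int ?l + 1..j. ennreal (w i \<iota>))"
    by (rule suminf_sum[symmetric]) (rule summableI)
  also have "\<dots> = (\<Sum>\<iota>. ennreal (sum f {\<iota> * ?l..<\<iota> * ?l + ?l}))"
    using w0 by (simp add: group)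
  also have "\<dots> = ennreal (stationary_effect q r \<Xi> j)"
    using sums by (rule sums_unique[symmetric])
  finally show ?thesis .
qed

section \<open>The hazard as a sum over lags\<close>

lemma hazard_reverse:
  "hazard \<Psi> q r x = \<Psi> (ennreal (\<Sum>k<length x. q (x ! (length x - Suc k)) * decay r k))"
proof -
  have "(\<Sum>s=1..length x. q (x ! (s - 1)) * (real (length x) - real s + 1) powr (- r))
      = (\<Sum>k<length x. q (x ! (length x - Suc k)) * decay r k)"
    by (rule sum.reindex_bij_witness[of _ "\<lambda>k. length x - k" "\<lambda>s. length x - s"])
      (auto simp: decay_def of_nat_diff algebra_simps)
  then show ?thesis
    by (simp add: hazard_def)
qed

lemma length_seg: "length (seg \<Xi> j (int s + j - 1)) = s"
  by (simp add: seg_def)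

text \<open>Lags below \<open>s\<close> reach back only into the block, so \<open>z\<close> drops
  out and the history agrees with the periodic past ending at position
  \<open>s + j - 1\<close>.\<close>

lemma nth_append_seg:
  assumes "k < s"
  shows "(z @ seg \<Xi> j (int s + j - 1)) ! (length z + s - Suc k) = cyc \<Xi> (int s + j - 1 - int k)"
proof -
  have eq: "length z + s - Suc k = length z + (s - Suc k)"
    using assms by simp
  show ?thesis
    unfolding eq nth_append_length_plus
    using assms by (simp add: seg_def nth_upto of_nat_diff algebra_simps)
qed

lemma set_seg_subset:
  assumes "\<Xi> \<noteq> []"
  shows "set (seg \<Xi> i j) \<subseteq> set \<Xi>"
  using cyc_in_set[OF assms] by (auto simp: seg_def)

section \<open>Uniform convergence of the averages\<close>

theorem lemmaG1:
  fixes K l :: nat and \<Psi> :: "ennreal \<Rightarrow> real" and q :: "nat \<Rightarrow> real" and r \<epsilon> :: real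
    and \<Xi> :: "nat list"
  assumes "K \<ge> 2"
    and "\<And>u. 0 \<le> \<Psi> u \<and> \<Psi> u < 1"
    and "\<And>x. x \<in> {1..K} \<Longrightarrow> q x \<ge> 0"
    and "continuous_on UNIV \<Psi>"
    and "r > 1"
    and "l \<ge> 1" and "\<Xi> \<in> words K l"
    and "\<epsilon> > 0"
  shows "\<exists>M0::nat. M0 \<ge> 1 \<and> (\<forall>M\<ge>M0.
    (SUP (t, z, j) \<in> (SIGMA t:(UNIV :: nat set). words K t \<times> {1..int l}).
       ereal \<bar>1 / real M * (\<Sum>s=1..M. omega (hazard \<Psi> q r (z @ seg \<Xi> j (int s + j - 1))))
              - dlim \<Psi> q r \<Xi>\<bar>) \<le> ereal \<epsilon>)"
proof -
  \<comment> \<open>\<open>Q\<close> bounds every single \<open>q x\<close>, hence \<open>B\<close>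
    bounds the effect of every history, finite or periodic. This places all link arguments in the
    compact interval \<open>{0..B}\<close>.\<close>
  define Q where "Q = (\<Sum>x\<in>{1..K}. q x)"
  define B where "B = Q * (\<Sum>k. decay r k)"
  define g where "g x = omega (\<Psi> (ennreal x))" for x
  define D where "D = dlim \<Psi> q r \<Xi>"
  let ?c = "stationary_effect q r \<Xi>"
  have len: "length \<Xi> = l" and set\<Xi>: "set \<Xi> \<subseteq> {1..K}" and ne: "\<Xi> \<noteq> []"
    using assms(6,7) by (auto simp: words_def)
  have q_bd: "0 \<le> q x \<and> q x \<le> Q" if "x \<in> {1..K}" for x
    using that assms(3) member_le_sum[of x "{1..K}" q] by (auto simp: Q_def)
  have qc: "0 \<le> q (cyc \<Xi> p)" "q (cyc \<Xi> p) \<le> Q" for p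
    using q_bd cyc_in_set[OF ne, of p] set\<Xi> by blast+
  have Q0: "0 \<le> Q"
    using qc[of 0] by linarith
  note sd = summable_decay[OF assms(5)]

  have c_bd: "?c p \<in> {0..B}" for p
  proof -
    have "0 \<le> ?c p"
      unfolding stationary_effect_def
      by (rule suminf_nonneg[OF summable_stationary_effect[of r q \<Xi> Q, OF assms(5) qc]])
        (simp add: qc decay_nonneg)
    moreover have "?c p \<le> (\<Sum>k. Q * decay r k)"
      unfolding stationary_effect_def
      by (rule suminf_le[OF _ summable_stationary_effect[of r q \<Xi> Q, OF assms(5) qc] summable_mult[OF sd]])
        (simp add: qc decay_nonneg mult_right_mono)
    ultimately show ?thesis
      using suminf_mult[OF sd, of Q] by (simp add: B_def)
  qed
  have cont: "continuous_on {0..B} g"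
  proof -
    have "continuous_on {0..B} (\<lambda>x. \<Psi> (ennreal x))"
      by (rule continuous_on_compose2[OF assms(4)]) (auto intro: continuous_on_ennreal)
    \<comment> \<open>The strict bound \<open>\<Psi> u < 1\<close> keeps the logarithm off its
      singularity.\<close>
    moreover have "1 - \<Psi> u \<noteq> 0" for u
      using assms(2)[of u] by simp
    ultimately show ?thesis
      unfolding g_def omega_def by (intro continuous_intros) auto
  qed
  have "bounded (g ` {0..B})"
    by (rule compact_imp_bounded[OF compact_continuous_image[OF cont compact_Icc]])
  then obtain G where "\<forall>x\<in>{0..B}. \<bar>g x\<bar> \<le> G"
    by (auto simp: bounded_iff)
  moreover have g0: "0 \<le> g x" for x
    by (simp add: g_def omega_def)
  ultimately have G: "g x \<le> G" if "x \<in> {0..B}" for x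
    using that by force
  have G0: "0 \<le> G"
    using G[OF c_bd[of 0]] g0[of "?c 0"] by linarith
  have "uniformly_continuous_on {0..B} g"
    by (rule compact_uniformly_continuous[OF cont compact_Icc])
  then obtain \<delta> where \<delta>: "\<delta> > 0"
    "\<And>x y. x \<in> {0..B} \<Longrightarrow> y \<in> {0..B} \<Longrightarrow> \<bar>x - y\<bar> < \<delta> \<Longrightarrow> \<bar>g x - g y\<bar> < \<epsilon> / 2"
    unfolding uniformly_continuous_on_def dist_real_def
    using assms(8) by (metis half_gt_zero)
  \<comment> \<open>The denominator \<open>Q + 1\<close> covers the case \<open>Q = 0\<close> and
    makes \<open>Q * (\<delta> / (Q + 1)) < \<delta>\<close> strict.\<close>
  have "0 < \<delta> / (Q + 1)"
    using \<delta> Q0 by simp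
  from suminf_exist_split[OF this sd] obtain S
    where S: "\<And>n. n \<ge> S \<Longrightarrow> \<bar>\<Sum>k. decay r (k + n)\<bar> < \<delta> / (Q + 1)"
    by auto
  have tail: "Q * (\<Sum>k. decay r (k + n)) < \<delta>" if "n \<ge> S" for n
  proof -
    have "Q * (\<Sum>k. decay r (k + n)) \<le> Q * (\<delta> / (Q + 1))"
      using S[OF that] Q0 by (intro mult_left_mono) auto
    also have "\<dots> < \<delta>"
      using \<delta> Q0 by (simp add: field_simps)
    finally show ?thesis .
  qed

  have D_eq: "D = 1 / real l * (\<Sum>j=1..int l. g (?c j))"
    by (simp add: D_def dlim_def g_def len chi_eq_stationary_effect[of r \<Xi> q Q, OF assms(5) ne qc])

  \<comment> \<open>Three errors add up: the first \<open>S\<close> steps, where \<open>z\<close>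
    may still matter; \<epsilon>/2 per step from uniform continuity; and an incomplete period. None
    depends on \<open>t\<close>, \<open>z\<close> or \<open>j\<close>.\<close>
  have main: "\<bar>(\<Sum>s=1..M. omega (hazard \<Psi> q r (z @ seg \<Xi> j (int s + j - 1)))) - real M * D\<bar>
      \<le> real S * G + real M * (\<epsilon> / 2) + real l * G"
    if z: "z \<in> words K t" for M t z j
  proof -
    define x where "x s = z @ seg \<Xi> j (int s + j - 1)" for s
    define A where "A s = (\<Sum>k<length (x s). q (x s ! (length (x s) - Suc k)) * decay r k)" for s
    have lx: "length (x s) = length z + s" for s
      by (simp add: x_def length_seg)
    have setx: "set (x s) \<subseteq> {1..K}" for s
      using z set_seg_subset[OF ne] set\<Xi> by (fastforce simp: x_def words_def)
    have qx: "0 \<le> q (x s ! (length (x s) - Suc k)) \<and> q (x s ! (length (x s) - Suc k)) \<le> Q"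
      if "k < length (x s)" for s k
      using that by (intro q_bd subsetD[OF setx[of s]] nth_mem) simp
    have A_bd: "A s \<in> {0..B}" for s
    proof -
      have "A s \<le> (\<Sum>k<length (x s). Q * decay r k)"
        unfolding A_def using qx by (intro sum_mono mult_right_mono) (auto simp: decay_nonneg)
      also have "\<dots> \<le> (\<Sum>k. Q * decay r k)"
        by (rule sum_le_suminf[OF summable_mult[OF sd]]) (auto simp: decay_nonneg Q0)
      finally show ?thesis
        using suminf_mult[OF sd, of Q] qx by (auto simp: B_def A_def decay_nonneg intro!: sum_nonneg)
    qed
    have close: "\<bar>A s - ?c (int s + j - 1)\<bar> \<le> Q * (\<Sum>k. decay r (k + s))" for s
      unfolding A_def stationary_effect_def
      by (rule weighted_sum_tail_bound)
        (use qx qc sd nth_append_seg[of _ s z \<Xi> j] in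
          \<open>auto simp: decay_nonneg lx x_def[symmetric]\<close>)
    \<comment> \<open>Up to \<open>S\<close> it is enough that both values lie in
      \<open>[0, G]\<close>; later the arguments are less than \<delta> apart.\<close>
    have term_bd: "\<bar>g (A s) - g (?c (int s + j - 1))\<bar> \<le> (if s \<le> S then G else 0) + \<epsilon> / 2" for s
    proof (cases "s \<le> S")
      case True
      then show ?thesis
        using G[OF A_bd[of s]] G[OF c_bd[of "int s + j - 1"]] g0[of "A s"]
          g0[of "?c (int s + j - 1)"] assms(8) by (simp add: abs_le_iff)
    next
      case False
      then show ?thesis
        using \<delta>(2)[OF A_bd c_bd order.strict_trans1[OF close tail], of s] by simp
    qed
    have "\<bar>(\<Sum>s=1..M. g (A s)) - (\<Sum>s=1..M. g (?c (int s + j - 1)))\<bar>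
        \<le> (\<Sum>s=1..M. \<bar>g (A s) - g (?c (int s + j - 1))\<bar>)"
      by (simp add: sum_subtractf[symmetric])
    also have "\<dots> \<le> (\<Sum>s=1..M. (if s \<le> S then G else 0) + \<epsilon> / 2)"
      by (intro sum_mono term_bd)
    also have "\<dots> = (\<Sum>s\<in>{1..M} \<inter> {..S}. G) + real M * (\<epsilon> / 2)"
      unfolding sum.inter_restrict[OF finite_atLeastAtMost] by (simp add: sum.distrib)
    also have "(\<Sum>s\<in>{1..M} \<inter> {..S}. G) \<le> real S * G"
    proof -
      have "card ({1..M} \<inter> {..S}) \<le> card {1..S}"
        by (rule card_mono) auto
      then show ?thesis
        using G0 by (simp add: mult_right_mono)
    qed
    finally have 1: "\<bar>(\<Sum>s=1..M. g (A s)) - (\<Sum>s=1..M. g (?c (int s + j - 1)))\<bar>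
        \<le> real S * G + real M * (\<epsilon> / 2)"
      by simp
    have "(\<Sum>s=1..M. g (?c (int s + j - 1))) = (\<Sum>m<M. g (?c (j + int m)))"
      by (rule sum.reindex_bij_witness[of _ Suc "\<lambda>s. s - 1"]) (auto simp: algebra_simps of_nat_diff)
    then have 2: "\<bar>(\<Sum>s=1..M. g (?c (int s + j - 1))) - real M * D\<bar> \<le> real l * G"
      using periodic_partial_sum_bound[of "\<lambda>p. g (?c p)" l G D j M]
        stationary_effect_periodic[of q r \<Xi>] assms(6) g0 G c_bd D_eq by (simp add: len)
    have "(\<Sum>s=1..M. omega (hazard \<Psi> q r (z @ seg \<Xi> j (int s + j - 1)))) = (\<Sum>s=1..M. g (A s))"
      by (simp add: hazard_reverse g_def A_def x_def)
    then show ?thesis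
      using 1 2 by linarith
  qed

  \<comment> \<open>From \<open>M0\<close> on, the constant errors total at most
    \<open>M * \<epsilon> / 2\<close>, the half left over by uniform continuity.\<close>
  obtain M0 :: nat where M0: "M0 \<ge> 1" "real M0 \<ge> 2 * (real S * G + real l * G) / \<epsilon>"
    by (metis real_arch_simple nat_le_linear of_nat_mono order_trans)
  show ?thesis
  proof (intro exI[of _ M0] conjI allI impI SUP_least)
    fix M and i :: "nat \<times> nat list \<times> int"
    assume M: "M0 \<le> M" and "i \<in> (SIGMA t:UNIV. words K t \<times> {1..int l})"
    then obtain t z j where i: "i = (t, z, j)" and z: "z \<in> words K t"
      by auto
    let ?T = "\<Sum>s=1..M. omega (hazard \<Psi> q r (z @ seg \<Xi> j (int s + j - 1)))"
    have Mpos: "0 < real M"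
      using M M0 by simp
    have "2 * (real S * G + real l * G) / \<epsilon> \<le> real M"
      using M M0(2) by linarith
    then have "2 * (real S * G + real l * G) \<le> real M * \<epsilon>"
      using assms(8) by (simp add: pos_divide_le_eq)
    then have "\<bar>?T - real M * D\<bar> \<le> real M * \<epsilon>"
      using main[OF z, of j M] by argo
    moreover have "1 / real M * ?T - D = (?T - real M * D) / real M"
      using Mpos by (simp add: field_simps)
    ultimately have "\<bar>1 / real M * ?T - D\<bar> \<le> \<epsilon>"
      using Mpos by (simp add: abs_divide pos_divide_le_eq mult.commute)
    then show "(case i of (t, z, j) \<Rightarrow>
        ereal \<bar>1 / real M * (\<Sum>s=1..M. omega (hazard \<Psi> q r (z @ seg \<Xi> j (int s + j - 1))))
          - dlim \<Psi> q r \<Xi>\<bar>) \<le> ereal \<epsilon>"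
      by (simp add: i D_def)
  qed (rule M0(1))
qed

end
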